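(* Let $q,t,s_1,s_2$ be independent indeterminates. The formal power series in $x_2/x_1$ $$f(x_1,x_2;s_1,s_2,q,t)=(1-x_2/x_1)\sum_{\theta=0}^\infty t^{\theta}\,\frac{(qt^{-1};q)_{\theta}}{(q;q)_{\theta}}\,\frac{(qt^{-1}s_1/s_2;q)_{\theta}}{(qs_1/s_2;q)_{\theta}}\,(x_2/x_1)^{\theta}$$ is an eigenfunction of the operator $D^1(s_1,s_2,q,t)$ with eigenvalue $s_1+s_2$: $$D^1(s_1,s_2,q,t)\, f(x_1,x_2;s_1,s_2,q,t)=(s_1+s_2)\, f(x_1,x_2;s_1,s_2,q,t).$$
   Context: Notation: $(a;q)_m=(1-a)(1-aq)\cdots(1-aq^{m-1})$ for integers $m\ge 0$ (with $(a;q)_0=1$). Let $F=\mathbf{Q}(q,t,s_1,s_2)$. The modified Macdonald difference operator $D^1(s_1,s_2,q,t)$ acts on the space of formal power series $F[[x_2/x_1]]$ by $$D^1(s_1,s_2,q,t)=s_1\,\frac{1-qt^{-1}x_2/x_1}{1-q\,x_2/x_1}\,T_{q^{-1},x_1}+s_2\,\frac{1-q^{-1}t\,x_2/x_1}{1-q^{-1}x_2/x_1}\,T_{q^{-1},x_2},$$ where $T_{q^{-1},x_i}$ is the shift operator replacing $x_i$ by $q^{-1}x_i$ (and leaving the other variable unchanged), and the rational factors are understood as the power series $$\frac{1-q^{\pm1}t^{\mp1}x}{1-q^{\pm1}x}=1+\sum_{m=1}^\infty(1-t^{\mp1})q^{\pm m}x^m .$$ *)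

theory Defs
  imports "HOL-Computational_Algebra.Computational_Algebra"
begin

text \<open>
  The field of rational functions \<open>\<rat>(q,t,s\<^sub>1,s\<^sub>2)\<close> is the fraction field of
  \<open>\<rat>[q][t][s\<^sub>1][s\<^sub>2]\<close>; the innermost polynomial variable is \<open>q\<close> and the outermost is \<open>s\<^sub>2\<close>.
\<close>

type_synonym ratfun = "rat poly poly poly poly fract"

definition indet_q :: ratfun where
  "indet_q = Fraction_Field.Fract [:[:[:[:0, 1:]:]:]:] 1"

definition indet_t :: ratfun where
  "indet_t = Fraction_Field.Fract [:[:[:0, 1:]:]:] 1"

definition indet_s1 :: ratfun where
  "indet_s1 = Fraction_Field.Fract [:[:0, 1:]:] 1"

definition indet_s2 :: ratfun where
  "indet_s2 = Fraction_Field.Fract [:0, 1:] 1"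

definition qpoch :: "'a::comm_ring_1 \<Rightarrow> 'a \<Rightarrow> nat \<Rightarrow> 'a" where
  "qpoch a q m = (\<Prod>k<m. 1 - a * q ^ k)"

text \<open>
  A formal power series in \<open>x\<^sub>2/x\<^sub>1\<close> is an element of the type \<open>fps\<close>, with \<open>fps_X\<close> standing
  for \<open>x\<^sub>2/x\<^sub>1\<close>. Replacing \<open>x\<^sub>1\<close> by \<open>c x\<^sub>1\<close> multiplies \<open>x\<^sub>2/x\<^sub>1\<close> by \<open>1/c\<close>; replacing
  \<open>x\<^sub>2\<close> by \<open>c x\<^sub>2\<close> multiplies it by \<open>c\<close>.
\<close>

definition shift_x1 :: "'a::field \<Rightarrow> 'a fps \<Rightarrow> 'a fps" where
  "shift_x1 c f = fps_compose f (fps_const (inverse c) * fps_X)"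

definition shift_x2 :: "'a::field \<Rightarrow> 'a fps \<Rightarrow> 'a fps" where
  "shift_x2 c f = fps_compose f (fps_const c * fps_X)"

text \<open>The power series expansion of \<open>(1 - a b x) / (1 - a x)\<close>, where \<open>x = x\<^sub>2/x\<^sub>1\<close>.\<close>

definition ratio_series :: "'a::field \<Rightarrow> 'a \<Rightarrow> 'a fps" where
  "ratio_series a b = 1 + Abs_fps (\<lambda>m. if m = 0 then 0 else (1 - b) * a ^ m)"

lemma ratio_series_mult:
  "ratio_series a b * (1 - fps_const a * fps_X) = 1 - fps_const (a * b) * fps_X"
proof (rule fps_ext)
  fix n
  have nth: "fps_nth (ratio_series a b) m = (if m = 0 then 1 else (1 - b) * a ^ m)" for m
    by (simp add: ratio_series_def)
  have "ratio_series a b * (1 - fps_const a * fps_X)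
      = ratio_series a b - fps_const a * (ratio_series a b * fps_X)"
    by (simp add: right_diff_distrib mult.left_commute)
  moreover have "n = 0 \<or> n = 1 \<or> (\<exists>k. n = Suc (Suc k))"
    by presburger
  ultimately show "fps_nth (ratio_series a b * (1 - fps_const a * fps_X)) n
      = fps_nth (1 - fps_const (a * b) * fps_X) n"
    by (auto simp: nth algebra_simps)
qed

definition macdonald_D1 :: "'a::field \<Rightarrow> 'a \<Rightarrow> 'a \<Rightarrow> 'a \<Rightarrow> 'a fps \<Rightarrow> 'a fps" where
  "macdonald_D1 s1 s2 q t f =
     fps_const s1 * ratio_series q (inverse t) * shift_x1 (inverse q) f
   + fps_const s2 * ratio_series (inverse q) t * shift_x2 (inverse q) f"

definition macdonald_f :: "'a::field \<Rightarrow> 'a \<Rightarrow> 'a \<Rightarrow> 'a \<Rightarrow> 'a fps" where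
  "macdonald_f s1 s2 q t =
     (1 - fps_X) * Abs_fps (\<lambda>\<theta>. t ^ \<theta>
        * (qpoch (q / t) q \<theta> / qpoch q q \<theta>)
        * (qpoch (q / t * s1 / s2) q \<theta> / qpoch (q * s1 / s2) q \<theta>))"

end

theory Submission
  imports Defs
begin

text \<open>
  Write \<open>f = (1 - x) g\<close> with \<open>x = x\<^sub>2/x\<^sub>1\<close>. The two shifts turn the factor \<open>1 - x\<close> into \<open>1 - q x\<close> and
  \<open>1 - x/q\<close>, which cancel the denominators of the operator, so the eigenvalue equation becomes
  \<open>s\<^sub>1 (1 - q x/t) g(q x) + s\<^sub>2 (1 - t x/q) g(x/q) = (s\<^sub>1 + s\<^sub>2) (1 - x) g(x)\<close>.
  Comparing coefficients gives a first-order recurrence whose two sides factor, and it is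
  exactly the recurrence satisfied by the hypergeometric coefficients of \<open>g\<close>.
\<close>

lemma qpoch_0 [simp]: "qpoch a q 0 = 1"
  by (simp add: qpoch_def)

lemma qpoch_Suc: "qpoch a q (Suc n) = qpoch a q n * (1 - a * q ^ n)"
  by (simp add: qpoch_def)

lemma shift_x1_mult: "shift_x1 c (f * g) = shift_x1 c f * shift_x1 c g"
  by (simp add: shift_x1_def fps_compose_mult_distrib)

lemma shift_x2_mult: "shift_x2 c (f * g) = shift_x2 c f * shift_x2 c g"
  by (simp add: shift_x2_def fps_compose_mult_distrib)

lemma shift_x1_one_minus_X: "shift_x1 c (1 - fps_X) = 1 - fps_const (inverse c) * fps_X"
  by (simp add: shift_x1_def fps_compose_sub_distrib)

lemma shift_x2_one_minus_X: "shift_x2 c (1 - fps_X) = 1 - fps_const c * fps_X"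
  by (simp add: shift_x2_def fps_compose_sub_distrib)

lemma macdonald_D1_one_minus_X_mult:
  "macdonald_D1 s1 s2 q t ((1 - fps_X) * g) =
     fps_const s1 * (1 - fps_const (q / t) * fps_X) * shift_x1 (inverse q) g
   + fps_const s2 * (1 - fps_const (t / q) * fps_X) * shift_x2 (inverse q) g"
proof -
  have "macdonald_D1 s1 s2 q t ((1 - fps_X) * g) =
     fps_const s1 * (ratio_series q (inverse t) * (1 - fps_const q * fps_X)) * shift_x1 (inverse q) g
   + fps_const s2 * (ratio_series (inverse q) t * (1 - fps_const (inverse q) * fps_X))
       * shift_x2 (inverse q) g"
    unfolding macdonald_D1_def shift_x1_mult shift_x2_mult shift_x1_one_minus_X shift_x2_one_minus_X
    by (simp only: inverse_inverse_eq mult.assoc)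
  then show ?thesis
    unfolding ratio_series_mult by (simp add: divide_inverse mult.commute)
qed

text \<open>The recurrence is cross-multiplied, so the only divisors here are \<open>q\<close>,
  \<open>t\<close> and \<open>s2\<close>; the poles of the hypergeometric coefficients are dealt
  with separately.\<close>

lemma macdonald_recurrence_imp_eigen:
  fixes c :: "nat \<Rightarrow> 'a::field"
  assumes q: "q \<noteq> 0" and t: "t \<noteq> 0" and s2: "s2 \<noteq> 0"
    and rec: "\<And>n. (1 - q ^ Suc n) * (1 - q ^ Suc n * s1 / s2) * c (Suc n)
                = t * (1 - q ^ Suc n / t) * (1 - q ^ Suc n * s1 / (t * s2)) * c n"
  shows "macdonald_D1 s1 s2 q t ((1 - fps_X) * Abs_fps c)
       = fps_const (s1 + s2) * ((1 - fps_X) * Abs_fps c)"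
proof (rule fps_ext)
  fix n
  have s1g: "shift_x1 (inverse q) (Abs_fps c) = Abs_fps (\<lambda>n. q ^ n * c n)"
    by (simp add: shift_x1_def fps_compose_linear)
  have s2g: "shift_x2 (inverse q) (Abs_fps c) = Abs_fps (\<lambda>n. inverse q ^ n * c n)"
    by (simp add: shift_x2_def fps_compose_linear)
  have lin: "fps_nth (fps_const a * (1 - fps_const b * fps_X) * h) n
      = a * (fps_nth h n - (if n = 0 then 0 else b * fps_nth h (n - 1)))" for a b :: 'a and h
    by (simp add: left_diff_distrib mult.assoc)
  have lin1: "fps_nth (fps_const a * ((1 - fps_X) * h)) n
      = a * (fps_nth h n - (if n = 0 then 0 else fps_nth h (n - 1)))" for a :: 'a and h
    by (simp add: left_diff_distrib)
  show "fps_nth (macdonald_D1 s1 s2 q t ((1 - fps_X) * Abs_fps c)) n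
      = fps_nth (fps_const (s1 + s2) * ((1 - fps_X) * Abs_fps c)) n"
  proof (cases n)
    case 0
    then show ?thesis
      unfolding macdonald_D1_one_minus_X_mult s1g s2g fps_add_nth lin lin1
      by (simp add: algebra_simps)
  next
    case (Suc m)
    define Q where "Q = q ^ Suc m"
    have Q: "Q \<noteq> 0" using q by (simp add: Q_def)
    have pow: "q ^ m = Q / q" "inverse q ^ m = q / Q" "inverse q ^ Suc m = 1 / Q"
      using q by (simp_all add: Q_def field_simps)
    \<comment> \<open>The recurrence multiplied by \<open>t * s2\<close>, which clears its
      denominators.\<close>
    have R: "(1 - Q) * (s2 - Q * s1) * c (Suc m) * t = (t - Q) * (t * s2 - Q * s1) * c m"
    proof -
      have fac: "s2 - Q * s1 = (1 - Q * s1 / s2) * s2" "t - Q = t * (1 - Q / t)"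
        "t * s2 - Q * s1 = (1 - Q * s1 / (t * s2)) * (t * s2)"
        using t s2 by (simp_all add: field_simps)
      show ?thesis
        unfolding fac using rec[of m, folded Q_def] by algebra
    qed
    \<comment> \<open>With everything moved to the left, \<open>c (Suc m)\<close> has the factor
      \<open>(1 - Q) * (s2 - Q * s1) / Q\<close> and \<open>c m\<close> the factor
      \<open>- (t - Q) * (t * s2 - Q * s1) / (t * Q)\<close>, so this is \<open>R\<close> divided by
      \<open>t * Q\<close>.\<close>
    have "s1 * (Q * c (Suc m) - q / t * (Q / q * c m))
        + s2 * (1 / Q * c (Suc m) - t / q * (q / Q * c m))
        = (s1 + s2) * (c (Suc m) - c m)"
      using R q t Q by (simp add: field_simps)
    then show ?thesis
      unfolding macdonald_D1_one_minus_X_mult s1g s2g fps_add_nth lin lin1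
      by (simp only: Suc fps_nth_Abs_fps diff_Suc_1 nat.distinct if_False pow Q_def[symmetric])
  qed
qed

text \<open>The conditions \<open>q_pow\<close> and \<open>q_s\<close> keep \<open>(q;q)_n\<close>
  and \<open>(q s1/s2;q)_n\<close> nonzero, so the ratio of consecutive coefficients is the one that
  the recurrence demands.\<close>

theorem macdonald_f_eigen:
  fixes q :: "'a::field"
  assumes q: "q \<noteq> 0" and t: "t \<noteq> 0" and s2: "s2 \<noteq> 0"
    and q_pow: "\<And>n. q ^ Suc n \<noteq> 1" and q_s: "\<And>n. q ^ Suc n * s1 \<noteq> s2"
  shows "macdonald_D1 s1 s2 q t (macdonald_f s1 s2 q t)
       = fps_const (s1 + s2) * macdonald_f s1 s2 q t"
  unfolding macdonald_f_def
proof (rule macdonald_recurrence_imp_eigen[OF q t s2])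
  fix n
  define A where "A = t ^ n * (qpoch (q / t) q n / qpoch q q n)
        * (qpoch (q / t * s1 / s2) q n / qpoch (q * s1 / s2) q n)"
  have "1 - q ^ Suc n \<noteq> 0" "1 - q ^ Suc n * s1 / s2 \<noteq> 0"
    using q_pow[of n] q_s[of n] s2 by (auto simp: field_simps)
  moreover have "t ^ Suc n * (qpoch (q / t) q (Suc n) / qpoch q q (Suc n))
        * (qpoch (q / t * s1 / s2) q (Suc n) / qpoch (q * s1 / s2) q (Suc n))
      = A * (t * (1 - q ^ Suc n / t) * (1 - q ^ Suc n * s1 / (t * s2))
         / ((1 - q ^ Suc n) * (1 - q ^ Suc n * s1 / s2)))"
    unfolding qpoch_Suc A_def by (simp add: mult_ac)
  ultimately show "(1 - q ^ Suc n) * (1 - q ^ Suc n * s1 / s2) *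
      (t ^ Suc n * (qpoch (q / t) q (Suc n) / qpoch q q (Suc n))
        * (qpoch (q / t * s1 / s2) q (Suc n) / qpoch (q * s1 / s2) q (Suc n)))
    = t * (1 - q ^ Suc n / t) * (1 - q ^ Suc n * s1 / (t * s2)) *
      (t ^ n * (qpoch (q / t) q n / qpoch q q n)
        * (qpoch (q / t * s1 / s2) q n / qpoch (q * s1 / s2) q n))"
    unfolding A_def[symmetric] by simp
qed

text \<open>The constant coefficient is 1. This makes the series a genuine eigenfunction.\<close>

lemma macdonald_f_nonzero: "macdonald_f s1 s2 q t \<noteq> 0"
proof
  assume "macdonald_f s1 s2 q t = 0"
  then have "fps_nth (macdonald_f s1 s2 q t) 0 = 0" by simp
  then show False by (simp add: macdonald_f_def)
qed

lemma Fract_1_eq_iff: "Fraction_Field.Fract a 1 = Fraction_Field.Fract b 1 \<longleftrightarrow> a = b"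
  by (simp add: eq_fract)

lemma Fract_1_power: "Fraction_Field.Fract a 1 ^ n = Fraction_Field.Fract (a ^ n) 1"
  by (induction n) (simp_all add: One_fract_def)

lemma indet_q_power: "indet_q ^ n = Fraction_Field.Fract [:[:[:[:0, 1:] ^ n:]:]:] 1"
  by (simp add: indet_q_def Fract_1_power poly_const_pow)

lemma indet_nonzero: "indet_q \<noteq> 0" "indet_t \<noteq> 0" "indet_s2 \<noteq> 0"
  by (simp_all add: indet_q_def indet_t_def indet_s2_def Zero_fract_def Fract_1_eq_iff)

lemma indet_q_power_neq_1: "indet_q ^ Suc n \<noteq> 1"
proof
  assume "indet_q ^ Suc n = 1"
  then have "[:0, 1 :: rat:] ^ Suc n = 1"
    unfolding indet_q_power One_fract_def Fract_1_eq_iff by (simp add: one_pCons)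
  \<comment> \<open>The degree in \<open>q\<close> is in fact \<open>Suc n\<close>.\<close>
  then have "degree ([:0, 1 :: rat:] ^ Suc n) = 0" by simp
  then show False by (simp add: degree_power_eq del: power_Suc)
qed

text \<open>The left side is constant in the outermost variable, while \<open>indet_s2\<close> is
  that variable itself.\<close>

lemma indet_q_power_mult_s1_neq_s2: "indet_q ^ n * indet_s1 \<noteq> indet_s2"
  by (simp add: indet_q_power indet_s1_def indet_s2_def Fract_1_eq_iff)

theorem mainTheorem1:
  shows "macdonald_f indet_s1 indet_s2 indet_q indet_t \<noteq> 0 \<and>
    macdonald_D1 indet_s1 indet_s2 indet_q indet_t (macdonald_f indet_s1 indet_s2 indet_q indet_t)
      = fps_const (indet_s1 + indet_s2) * macdonald_f indet_s1 indet_s2 indet_q indet_t"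
  using macdonald_f_nonzero
    macdonald_f_eigen[OF indet_nonzero indet_q_power_neq_1 indet_q_power_mult_s1_neq_s2]
  by blast

end
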